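(* Let $\mathcal{V}$ be a finite set of nodes whose profiles are partitioned into classes $\mathcal{C}=\{C_1,\ldots,C_h\}$, let $\mathrm{f}:\mathbb{R}\to\mathbb{R}$ be any non-decreasing concave function, and let $r_j>0$ be a selection reward for each $v_j\in\mathcal{V}$. Then the class-based (partition-based) diversity function $div:2^{\mathcal{V}}\to\mathbb{R}$, $$div(S)=\sum_{l=1}^{h}\mathrm{f}\Bigl(\sum_{v_j\in C_l\cap S}r_j\Bigr),$$ is (nondecreasing) monotone and submodular.
   Context: Each node $v\in\mathcal{V}$ has a categorical profile; the multiset $\mathcal{D}$ of profiles of all nodes is partitioned into pairwise disjoint classes $\mathcal{C}=\{C_1,\ldots,C_h\}$ with $\bigcup_{l}C_l=\mathcal{D}$. A node is said to belong to the class containing its profile, and $C_l\cap S$ denotes the set of nodes in $S$ that belong to class $C_l$. A set function $F:2^{\mathcal{V}}\to\mathbb{R}$ is monotone if $F(S)\le F(T)$ whenever $S\subseteq T\subseteq\mathcal{V}$, and submodular if $F(S\cup\{v\})-F(S)\ge F(T\cup\{v\})-F(T)$ whenever $S\subseteq T\subseteq\mathcal{V}$ and $v\in\mathcal{V}\setminus T$. *)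

theory Defs
  imports "HOL-Analysis.Analysis" "HOL-Library.Multiset"
begin

definition submodular_on :: "'v set \<Rightarrow> ('v set \<Rightarrow> real) \<Rightarrow> bool" where
  "submodular_on V F \<longleftrightarrow>
     (\<forall>S T v. S \<subseteq> T \<and> T \<subseteq> V \<and> v \<in> V - T \<longrightarrow>
        F (S \<union> {v}) - F S \<ge> F (T \<union> {v}) - F T)"

definition profiles :: "('v \<Rightarrow> 'p) \<Rightarrow> 'v set \<Rightarrow> 'p multiset" where
  "profiles profile V = image_mset profile (mset_set V)"

text \<open>
  Disjointness means that distinct classes share no profile, so equal profiles always lie in the
  same class and every node belongs to exactly one class. For disjoint classes the multiset sum
  and the multiset union coincide. Empty classes are allowed.
\<close>

definition class_partition :: "'p multiset \<Rightarrow> nat \<Rightarrow> (nat \<Rightarrow> 'p multiset) \<Rightarrow> bool" where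
  "class_partition D h C \<longleftrightarrow>
     (\<forall>l\<in>{1..h}. \<forall>m\<in>{1..h}. l \<noteq> m \<longrightarrow> C l \<inter># C m = {#}) \<and>
     (\<Sum>l=1..h. C l) = D"

definition class_nodes :: "('v \<Rightarrow> 'p) \<Rightarrow> 'p multiset \<Rightarrow> 'v set \<Rightarrow> 'v set" where
  "class_nodes profile K S = {v \<in> S. profile v \<in># K}"

definition diversity ::
  "('v \<Rightarrow> 'p) \<Rightarrow> nat \<Rightarrow> (nat \<Rightarrow> 'p multiset) \<Rightarrow> (real \<Rightarrow> real) \<Rightarrow> ('v \<Rightarrow> real) \<Rightarrow> 'v set \<Rightarrow> real" where
  "diversity profile h C f r S = (\<Sum>l=1..h. f (\<Sum>v\<in>class_nodes profile (C l) S. r v))"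

end

theory Submission
  imports Defs
begin

text \<open>
  Each class contributes \<open>f\<close> of a nonnegative additive set function. Adding a node raises the
  argument of \<open>f\<close> by the same amount (its reward, or zero if it lies outside the class) for a
  small set as for a large one, and the increments of a concave function shrink as the base
  point grows.
\<close>

text \<open>Membership in \<open>A\<close> is asked of the two outer points only:
  \<open>concave_on A f\<close> makes \<open>A\<close> convex, so \<open>a + c\<close> and
  \<open>b\<close>, which lie between them, belong to \<open>A\<close> too.\<close>

lemma concave_on_increment_antimono:
  fixes f :: "real \<Rightarrow> real"
  assumes f: "concave_on A f" and A: "a \<in> A" "b + c \<in> A" and "a \<le> b" "0 \<le> c"
  shows "f (b + c) - f b \<le> f (a + c) - f a"
\<comment> \<open>The weight \<open>t\<close> used below divides by \<open>b + c - a\<close>, so the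
  degenerate segment is treated apart.\<close>
proof (cases "b + c - a = 0")
  case True
  then have "c = 0" "a = b"
    using assms by auto
  then show ?thesis by simp
next
  case False
  \<comment> \<open>\<open>a + c\<close> and \<open>b\<close> are mirror-image convex combinations of \<open>a\<close> and \<open>b + c\<close>\<close>
  define d where "d = b + c - a"
  define t where "t = c / d"
  have d: "d > 0" and t: "0 \<le> t" "t \<le> 1" and c: "c = t * d" and bc: "b + c = a + d"
    using False assms by (auto simp: d_def t_def divide_simps)
  have "(1 - t) * a + t * (b + c) = a + c"
    unfolding bc using bc c by (simp add: algebra_simps)
  then have "f (a + c) \<ge> (1 - t) * f a + t * f (b + c)"
    using concave_onD[OF f t A] by simp
  moreover have "(1 - (1 - t)) * a + (1 - t) * (b + c) = b"
    unfolding bc using bc c by (simp add: algebra_simps)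
  then have "f b \<ge> t * f a + (1 - t) * f (b + c)"
    using concave_onD[OF f _ _ A, of "1 - t"] t by simp
  \<comment> \<open>Added together, the two bounds give \<open>f a\<close> and
    \<open>f (b + c)\<close> total weight 1 each, so \<open>t\<close> cancels.\<close>
  ultimately show ?thesis by (simp add: algebra_simps)
qed

lemma class_nodes_mono: "S \<subseteq> T \<Longrightarrow> class_nodes p K S \<subseteq> class_nodes p K T"
  by (auto simp: class_nodes_def)

lemma finite_class_nodes: "finite S \<Longrightarrow> finite (class_nodes p K S)"
  by (simp add: class_nodes_def)

lemma sum_class_nodes_mono:
  fixes r :: "'v \<Rightarrow> real"
  assumes "finite T" "S \<subseteq> T" "\<And>v. v \<in> T \<Longrightarrow> 0 \<le> r v"
  shows "sum r (class_nodes p K S) \<le> sum r (class_nodes p K T)"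
  using assms by (intro sum_mono2 finite_class_nodes class_nodes_mono) (auto simp: class_nodes_def)

lemma sum_class_nodes_insert:
  fixes r :: "'v \<Rightarrow> real"
  assumes "finite S" "v \<notin> S"
  shows "sum r (class_nodes p K (insert v S)) =
    sum r (class_nodes p K S) + (if p v \<in># K then r v else 0)"
proof -
  have "class_nodes p K (insert v S) =
      (if p v \<in># K then insert v (class_nodes p K S) else class_nodes p K S)"
    by (auto simp: class_nodes_def)
  moreover have "v \<notin> class_nodes p K S"
    using assms by (simp add: class_nodes_def)
  ultimately show ?thesis
    using assms by (simp add: finite_class_nodes)
qed

text \<open>Holds class by class: nonnegative rewards make each class total grow with the set, and
  \<open>f\<close> preserves the order.\<close>

lemma mono_on_diversity:
  assumes "finite V" "mono f" "\<And>v. v \<in> V \<Longrightarrow> 0 \<le> r v"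
  shows "mono_on (Pow V) (diversity p h C f r)"
  unfolding diversity_def
proof (intro mono_onI sum_mono monoD[OF \<open>mono f\<close>] sum_class_nodes_mono)
  fix S T assume "T \<in> Pow V"
  then show "finite T" "\<And>v. v \<in> T \<Longrightarrow> 0 \<le> r v"
    using assms by (auto intro: finite_subset)
qed auto

lemma submodular_on_diversity:
  assumes V: "finite V" and f: "concave_on UNIV f" and r: "\<And>v. v \<in> V \<Longrightarrow> 0 \<le> r v"
  shows "submodular_on V (diversity p h C f r)"
  unfolding submodular_on_def
proof (intro allI impI)
  fix S T v assume "S \<subseteq> T \<and> T \<subseteq> V \<and> v \<in> V - T"
  then have ST: "S \<subseteq> T" and TV: "T \<subseteq> V" and v: "v \<in> V" "v \<notin> S" "v \<notin> T"
    by auto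
  have fin: "finite T" "finite S"
    using ST TV V by (auto intro: finite_subset)
  \<comment> \<open>For each class this supplies the premise \<open>a \<le> b\<close> of the
    increment lemma, with the totals over \<open>S\<close> and \<open>T\<close> as \<open>a\<close>
    and \<open>b\<close>.\<close>
  have "sum r (class_nodes p K S) \<le> sum r (class_nodes p K T)" for K
    using fin ST TV r by (intro sum_class_nodes_mono) auto
  \<comment> \<open>Merging each difference of sums into one sum over the classes reduces the claim
    to a single class, where \<open>c\<close> is \<open>r v\<close> or 0.\<close>
  then show "diversity p h C f r (T \<union> {v}) - diversity p h C f r T
      \<le> diversity p h C f r (S \<union> {v}) - diversity p h C f r S"
    using fin v r
    by (auto simp: diversity_def sum_class_nodes_insert simp flip: sum_subtractf
        intro!: sum_mono concave_on_increment_antimono[OF f])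
qed

theorem proposition6:
  fixes V :: "'v set" and profile :: "'v \<Rightarrow> 'p"
    and h :: nat and C :: "nat \<Rightarrow> 'p multiset"
    and f :: "real \<Rightarrow> real" and r :: "'v \<Rightarrow> real"
  assumes "finite V"
    and "class_partition (profiles profile V) h C"
    and "mono f" and "concave_on UNIV f"
    and "\<And>v. v \<in> V \<Longrightarrow> r v > 0"
  shows "mono_on (Pow V) (diversity profile h C f r) \<and>
         submodular_on V (diversity profile h C f r)"
  using assms by (simp add: mono_on_diversity submodular_on_diversity less_imp_le)

end
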